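(* Assume that the underlying order of $\mathcal{V}$ is linear (total), and consider a (symmetric) linear $\mathcal{V}\lambda$-theory. Replacing, in the deductive system defining its theorems, the rule "from $v=_{q_i}w$ for all $i\le n$ infer $v=_{\bigvee_{i} q_i}w$" by the axiom rule "$v=_\bot w$" (for all terms $v,w$ of the same type in the same context) does not change the class of theorems.
   Context: Standing assumptions on $\mathcal{V}$: commutative unital quantale (complete lattice with commutative associative $\otimes$ distributing over joins, unit $k$), integral ($k=\top$), continuous underlying lattice, with a fixed basis $B$ (for each $x$, $B\cap\{y\mid y\ll x\}$ is directed with join $x$, where $y\ll x$ means whenever $x\le\bigvee X$ some finite $A\subseteq X$ has $y\le\bigvee A$) closed under finite joins and $\otimes$ and containing $k$. A linear $\mathcal{V}\lambda$-theory $((G,\Sigma),Ax)$: linear $\lambda$-calculus over ground types $G$ and operation symbols $\Sigma$ ($f:A_1,\dots,A_n\to A$, $n\ge1$), with types $X\in G$, $I$, $A\otimes B$, $A\multimap B$ and terms $f(\vec v)$, variables, $\ast$, $v\ \mathtt{to}\ \ast.\,w$, $v\otimes w$, $\mathtt{pm}\ v\ \mathtt{to}\ x\otimes y.\,w$, $\lambda x.\,v$, $v\,w$ typed linearly; $Ax$ a class of $\mathcal{V}$-equations-in-context $\Gamma\rhd v=_q w:A$ with $q\in B$. Its theorems: the smallest class containing $Ax$, the equations $\mathtt{pm}\ v\otimes w\ \mathtt{to}\ x\otimes y.\,u=u[v/x,w/y]$, $\mathtt{pm}\ v\ \mathtt{to}\ x\otimes y.\,u[x\otimes y/z]=u[v/z]$,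 $\ast\ \mathtt{to}\ \ast.\,v=v$, $v\ \mathtt{to}\ \ast.\,w[\ast/z]=w[v/z]$, $(\lambda x.\,v)\,w=v[w/x]$, $\lambda x.(v\,x)=v$ and the commuting conversions $u[v\ \mathtt{to}\ \ast.\,w/z]=v\ \mathtt{to}\ \ast.\,u[w/z]$, $u[\mathtt{pm}\ v\ \mathtt{to}\ x\otimes y.\,w/z]=\mathtt{pm}\ v\ \mathtt{to}\ x\otimes y.\,u[w/z]$ (each $v=w$ read as $v=_\top w$ and $w=_\top v$), closed under: $v=_\top v$; $v=_q w,w=_r u\Rightarrow v=_{q\otimes r}u$; $v=_q w,r\le q\Rightarrow v=_r w$; (for all $r\ll q$, $v=_r w$) $\Rightarrow v=_q w$; the join rule (for all $i\le n$, $v=_{q_i}w$) $\Rightarrow v=_{\bigvee_i q_i}w$ with $n\ge0$; compatibility of $f$, $\otimes$, $\mathtt{pm}$, $\mathtt{to}$, application and substitution (labels combined by $\otimes$) and of $\lambda$ (label preserved); and permutation of contexts. A symmetric theory is one whose theorems are additionally closed under $v=_q w\Rightarrow w=_q v$. *)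

theory Defs
  imports "HOL-Library.Multiset"
begin

section \<open>Quantales with a basis\<close>

definition way_below :: "'v::complete_lattice \<Rightarrow> 'v \<Rightarrow> bool" (infix "\<lless>" 50) where
  "y \<lless> x \<longleftrightarrow> (\<forall>X. x \<le> Sup X \<longrightarrow> (\<exists>A\<subseteq>X. finite A \<and> y \<le> Sup A))"

definition directed :: "'v::order set \<Rightarrow> bool" where
  "directed D \<longleftrightarrow> D \<noteq> {} \<and> (\<forall>x\<in>D. \<forall>y\<in>D. \<exists>z\<in>D. x \<le> z \<and> y \<le> z)"

locale quantale =
  fixes tens :: "'v::complete_lattice \<Rightarrow> 'v \<Rightarrow> 'v"
    and unit :: 'v
  assumes tens_assoc: "tens (tens a b) c = tens a (tens b c)"
    and tens_commute: "tens a b = tens b a"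
    and tens_unit: "tens unit a = a"
    and tens_Sup: "tens a (Sup X) = (SUP x\<in>X. tens a x)"

locale based_quantale = quantale tens unit
  for tens :: "'v::complete_lattice \<Rightarrow> 'v \<Rightarrow> 'v" and unit :: 'v +
  fixes B :: "'v set"
  assumes integral: "unit = top"
    and continuous: "x = Sup {y. y \<lless> x}"
    and basis_directed: "directed (B \<inter> {y. y \<lless> x})"
    and basis_Sup: "Sup (B \<inter> {y. y \<lless> x}) = x"
    and basis_joins: "finite A \<Longrightarrow> A \<subseteq> B \<Longrightarrow> Sup A \<in> B"
    and basis_tens: "a \<in> B \<Longrightarrow> b \<in> B \<Longrightarrow> tens a b \<in> B"
    and basis_unit: "unit \<in> B"

section \<open>Types, signatures, terms\<close>

datatype 'g ty = Ground 'g | One | Tensor "'g ty" "'g ty" | Lolli "'g ty" "'g ty"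

record ('g, 'f) signature =
  grounds :: "'g set"
  ops :: "'f set"
  arg_tys :: "'f \<Rightarrow> 'g ty list"
  res_ty :: "'f \<Rightarrow> 'g ty"

definition types :: "('g, 'f) signature \<Rightarrow> 'g ty set" where
  "types S = {A. set_ty A \<subseteq> grounds S}"

definition wf_signature :: "('g, 'f) signature \<Rightarrow> bool" where
  "wf_signature S \<longleftrightarrow>
     (\<forall>f\<in>ops S. arg_tys S f \<noteq> [] \<and> set (arg_tys S f) \<subseteq> types S \<and> res_ty S f \<in> types S)"

type_synonym var = nat

text \<open>
  Terms modulo renaming of bound variables, in locally nameless style: free variables are named,
  variables bound by \<open>LAM\<close> (one) and \<open>PM\<close> (two, in its second argument) are de Bruijn indices.
  Only the named binders \<open>lam\<close> and \<open>pm\<close> below are used to state the calculus, so every typable term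
  is free of dangling indices. In particular substitution of typable terms for free variables needs
  no renaming.
\<close>

datatype 'f tm =
    Var var
  | Bound nat
  | Op 'f "'f tm list"
  | Star
  | To "'f tm" "'f tm"
  | TPair "'f tm" "'f tm"
  | PM "'f tm" "'f tm"
  | LAM "'f tm"
  | App "'f tm" "'f tm"

fun bind :: "nat \<Rightarrow> var \<Rightarrow> 'f tm \<Rightarrow> 'f tm" where
  "bind k x (Var y) = (if x = y then Bound k else Var y)"
| "bind k x (Bound i) = Bound i"
| "bind k x (Op f ts) = Op f (map (bind k x) ts)"
| "bind k x Star = Star"
| "bind k x (To s t) = To (bind k x s) (bind k x t)"
| "bind k x (TPair s t) = TPair (bind k x s) (bind k x t)"
| "bind k x (PM s t) = PM (bind k x s) (bind (k + 2) x t)"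
| "bind k x (LAM t) = LAM (bind (k + 1) x t)"
| "bind k x (App s t) = App (bind k x s) (bind k x t)"

definition lam :: "var \<Rightarrow> 'f tm \<Rightarrow> 'f tm" where
  "lam x v = LAM (bind 0 x v)"

text \<open>\<open>pm v x y w\<close> is \<open>pm v to x \<otimes> y. w\<close>; it is only used with \<open>x \<noteq> y\<close>.\<close>

definition pm :: "'f tm \<Rightarrow> var \<Rightarrow> var \<Rightarrow> 'f tm \<Rightarrow> 'f tm" where
  "pm v x y w = PM v (bind 0 x (bind 1 y w))"

text \<open>
  Substitution for free variables is simultaneous: in \<open>u[v/x, w/y]\<close> the variable \<open>y\<close> may be free in \<open>v\<close>.
\<close>

fun subst :: "(var \<Rightarrow> 'f tm) \<Rightarrow> 'f tm \<Rightarrow> 'f tm" where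
  "subst \<sigma> (Var y) = \<sigma> y"
| "subst \<sigma> (Bound i) = Bound i"
| "subst \<sigma> (Op f ts) = Op f (map (subst \<sigma>) ts)"
| "subst \<sigma> Star = Star"
| "subst \<sigma> (To s t) = To (subst \<sigma> s) (subst \<sigma> t)"
| "subst \<sigma> (TPair s t) = TPair (subst \<sigma> s) (subst \<sigma> t)"
| "subst \<sigma> (PM s t) = PM (subst \<sigma> s) (subst \<sigma> t)"
| "subst \<sigma> (LAM t) = LAM (subst \<sigma> t)"
| "subst \<sigma> (App s t) = App (subst \<sigma> s) (subst \<sigma> t)"

abbreviation subst1 :: "'f tm \<Rightarrow> var \<Rightarrow> 'f tm \<Rightarrow> 'f tm" where
  "subst1 u x v \<equiv> subst (Var(x := v)) u"

abbreviation subst2 :: "'f tm \<Rightarrow> var \<Rightarrow> 'f tm \<Rightarrow> var \<Rightarrow> 'f tm \<Rightarrow> 'f tm" where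
  "subst2 u x v y w \<equiv> subst (Var(x := v, y := w)) u"

fun frees :: "'f tm \<Rightarrow> var set" where
  "frees (Var y) = {y}"
| "frees (Bound i) = {}"
| "frees (Op f ts) = (\<Union>t\<in>set ts. frees t)"
| "frees Star = {}"
| "frees (To s t) = frees s \<union> frees t"
| "frees (TPair s t) = frees s \<union> frees t"
| "frees (PM s t) = frees s \<union> frees t"
| "frees (LAM t) = frees t"
| "frees (App s t) = frees s \<union> frees t"

lemma bind_rename: "y \<notin> frees v \<Longrightarrow> bind k y (subst1 v x (Var y)) = bind k x v"
  by (induction v arbitrary: k) auto

lemma lam_rename: "y \<notin> frees v \<Longrightarrow> lam y (subst1 v x (Var y)) = lam x v"
  by (simp add: lam_def bind_rename)

section \<open>Linear typing\<close>

type_synonym 'g ctx = "(var \<times> 'g ty) list"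

definition wf_ctx :: "'g ctx \<Rightarrow> bool" where
  "wf_ctx \<Gamma> \<longleftrightarrow> distinct (map fst \<Gamma>)"

abbreviation vars :: "'g ctx \<Rightarrow> var set" where
  "vars \<Gamma> \<equiv> fst ` set \<Gamma>"

text \<open>Interleavings of finitely many contexts, with repeated variables excluded.\<close>

fun interleavings :: "'a list list \<Rightarrow> 'a list set" where
  "interleavings [] = {[]}"
| "interleavings (xs # xss) = (\<Union>ys\<in>interleavings xss. shuffles xs ys)"

definition Sf :: "'g ctx list \<Rightarrow> 'g ctx set" where
  "Sf \<Gamma>s = {E \<in> interleavings \<Gamma>s. wf_ctx E}"

text \<open>As contexts are linear, every variable of \<open>\<Gamma>\<close> occurs exactly once in a term typed in \<open>\<Gamma>\<close>.\<close>

inductive typing :: "('g, 'f) signature \<Rightarrow> 'g ctx \<Rightarrow> 'f tm \<Rightarrow> 'g ty \<Rightarrow> bool"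
    ("_ \<turnstile> _ \<rhd> _ \<Colon> _" [50, 50, 50, 50] 50)
  for S :: "('g, 'f) signature"
where
  typ_op:
    "\<lbrakk>f \<in> ops S; length \<Gamma>s = length (arg_tys S f); length vs = length (arg_tys S f);
      \<And>i. i < length (arg_tys S f) \<Longrightarrow> S \<turnstile> \<Gamma>s ! i \<rhd> vs ! i \<Colon> arg_tys S f ! i;
      E \<in> Sf \<Gamma>s\<rbrakk> \<Longrightarrow> S \<turnstile> E \<rhd> Op f vs \<Colon> res_ty S f"
| typ_var: "A \<in> types S \<Longrightarrow> S \<turnstile> [(x, A)] \<rhd> Var x \<Colon> A"
| typ_star: "S \<turnstile> [] \<rhd> Star \<Colon> One"
| typ_to: "\<lbrakk>S \<turnstile> \<Gamma> \<rhd> v \<Colon> One; S \<turnstile> \<Delta> \<rhd> w \<Colon> A; E \<in> Sf [\<Gamma>, \<Delta>]\<rbrakk> \<Longrightarrow> S \<turnstile> E \<rhd> To v w \<Colon> A"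
| typ_pair:
    "\<lbrakk>S \<turnstile> \<Gamma> \<rhd> v \<Colon> A; S \<turnstile> \<Delta> \<rhd> w \<Colon> A'; E \<in> Sf [\<Gamma>, \<Delta>]\<rbrakk> \<Longrightarrow> S \<turnstile> E \<rhd> TPair v w \<Colon> Tensor A A'"
| typ_pm:
    "\<lbrakk>S \<turnstile> \<Gamma> \<rhd> v \<Colon> Tensor A A'; S \<turnstile> \<Delta> @ [(x, A), (y, A')] \<rhd> w \<Colon> C; E \<in> Sf [\<Gamma>, \<Delta>]\<rbrakk>
     \<Longrightarrow> S \<turnstile> E \<rhd> pm v x y w \<Colon> C"
| typ_lam: "S \<turnstile> \<Gamma> @ [(x, A)] \<rhd> v \<Colon> A' \<Longrightarrow> S \<turnstile> \<Gamma> \<rhd> lam x v \<Colon> Lolli A A'"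
| typ_app:
    "\<lbrakk>S \<turnstile> \<Gamma> \<rhd> v \<Colon> Lolli A A'; S \<turnstile> \<Delta> \<rhd> w \<Colon> A; E \<in> Sf [\<Gamma>, \<Delta>]\<rbrakk> \<Longrightarrow> S \<turnstile> E \<rhd> App v w \<Colon> A'"

text \<open>
  The equations of the linear lambda-calculus. The subterms are typed exactly as required for
  both sides to be typed in \<open>E\<close>; the freshness conditions on bound variables prevent capture.
\<close>

inductive lin_eq :: "('g, 'f) signature \<Rightarrow> 'g ctx \<Rightarrow> 'f tm \<Rightarrow> 'f tm \<Rightarrow> 'g ty \<Rightarrow> bool"
  for S :: "('g, 'f) signature"
where
  pm_beta:
    "\<lbrakk>S \<turnstile> \<Gamma> \<rhd> v \<Colon> A; S \<turnstile> \<Delta> \<rhd> w \<Colon> A'; S \<turnstile> \<Theta> @ [(x, A), (y, A')] \<rhd> u \<Colon> C; E \<in> Sf [\<Gamma>, \<Delta>, \<Theta>]\<rbrakk>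
     \<Longrightarrow> lin_eq S E (pm (TPair v w) x y u) (subst2 u x v y w) C"
| pm_eta:
    "\<lbrakk>S \<turnstile> \<Gamma> \<rhd> v \<Colon> Tensor A A'; S \<turnstile> \<Delta> @ [(z, Tensor A A')] \<rhd> u \<Colon> C;
      x \<noteq> y; x \<notin> vars \<Delta>; y \<notin> vars \<Delta>; E \<in> Sf [\<Gamma>, \<Delta>]\<rbrakk>
     \<Longrightarrow> lin_eq S E (pm v x y (subst1 u z (TPair (Var x) (Var y)))) (subst1 u z v) C"
| star_beta: "S \<turnstile> \<Gamma> \<rhd> v \<Colon> A \<Longrightarrow> lin_eq S \<Gamma> (To Star v) v A"
| star_eta:
    "\<lbrakk>S \<turnstile> \<Gamma> \<rhd> v \<Colon> One; S \<turnstile> \<Delta> @ [(z, One)] \<rhd> w \<Colon> A; E \<in> Sf [\<Gamma>, \<Delta>]\<rbrakk>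
     \<Longrightarrow> lin_eq S E (To v (subst1 w z Star)) (subst1 w z v) A"
| beta:
    "\<lbrakk>S \<turnstile> \<Gamma> @ [(x, A)] \<rhd> v \<Colon> A'; S \<turnstile> \<Delta> \<rhd> w \<Colon> A; E \<in> Sf [\<Gamma>, \<Delta>]\<rbrakk>
     \<Longrightarrow> lin_eq S E (App (lam x v) w) (subst1 v x w) A'"
| eta:
    "\<lbrakk>S \<turnstile> \<Gamma> \<rhd> v \<Colon> Lolli A A'; x \<notin> vars \<Gamma>\<rbrakk> \<Longrightarrow> lin_eq S \<Gamma> (lam x (App v (Var x))) v (Lolli A A')"
| comm_star:
    "\<lbrakk>S \<turnstile> \<Gamma> \<rhd> v \<Colon> One; S \<turnstile> \<Delta> \<rhd> w \<Colon> A; S \<turnstile> \<Theta> @ [(z, A)] \<rhd> u \<Colon> C; E \<in> Sf [\<Gamma>, \<Delta>, \<Theta>]\<rbrakk>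
     \<Longrightarrow> lin_eq S E (subst1 u z (To v w)) (To v (subst1 u z w)) C"
| comm_pm:
    "\<lbrakk>S \<turnstile> \<Gamma> \<rhd> v \<Colon> Tensor A A'; S \<turnstile> \<Delta> @ [(x, A), (y, A')] \<rhd> w \<Colon> C; S \<turnstile> \<Theta> @ [(z, C)] \<rhd> u \<Colon> D;
      x \<notin> vars \<Theta>; y \<notin> vars \<Theta>; E \<in> Sf [\<Gamma>, \<Delta>, \<Theta>]\<rbrakk>
     \<Longrightarrow> lin_eq S E (subst1 u z (pm v x y w)) (pm v x y (subst1 u z w)) D"

section \<open>Theories and their theorems\<close>

text \<open>\<open>Eq \<Gamma> v q w A\<close> is the equation-in-context \<open>\<Gamma> \<rhd> v =\<^sub>q w : A\<close>.\<close>

datatype ('g, 'f, 'v) equation = Eq "'g ctx" "'f tm" 'v "'f tm" "'g ty"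

definition equations :: "('g, 'f) signature \<Rightarrow> 'v set \<Rightarrow> ('g, 'f, 'v) equation set" where
  "equations S B = {Eq \<Gamma> v q w A | \<Gamma> v q w A. S \<turnstile> \<Gamma> \<rhd> v \<Colon> A \<and> S \<turnstile> \<Gamma> \<rhd> w \<Colon> A \<and> q \<in> B}"

definition linear_theory ::
    "'v set \<Rightarrow> ('g, 'f) signature \<Rightarrow> ('g, 'f, 'v) equation set \<Rightarrow> bool" where
  "linear_theory B S Ax \<longleftrightarrow> wf_signature S \<and> Ax \<subseteq> equations S B"

text \<open>
  The deductive system comes with either the rule for finite joins or the axiom for the
  bottom label, and (for symmetric theories) optionally with the symmetry rule. As
  labels of equations lie in \<open>B\<close>, the rules \<open>weak\<close> and \<open>arch\<close> only refer to labels in \<open>B\<close>.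
\<close>

datatype join_rule = Finite_Joins | Bottom_Axiom

context
  fixes tens :: "'v::complete_lattice \<Rightarrow> 'v \<Rightarrow> 'v"
    and unit :: 'v
    and B :: "'v set"
    and J :: join_rule
    and symmetric :: bool
    and S :: "('g, 'f) signature"
    and Ax :: "('g, 'f, 'v) equation set"
begin

inductive_set theorems :: "('g, 'f, 'v) equation set" where
  ax: "e \<in> Ax \<Longrightarrow> e \<in> theorems"
| lin_eq: "lin_eq S \<Gamma> v w A \<Longrightarrow> Eq \<Gamma> v top w A \<in> theorems"
| lin_eq_converse: "lin_eq S \<Gamma> v w A \<Longrightarrow> Eq \<Gamma> w top v A \<in> theorems"
| refl: "S \<turnstile> \<Gamma> \<rhd> v \<Colon> A \<Longrightarrow> Eq \<Gamma> v top v A \<in> theorems"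
| trans:
    "\<lbrakk>Eq \<Gamma> v q w A \<in> theorems; Eq \<Gamma> w r u A \<in> theorems\<rbrakk> \<Longrightarrow> Eq \<Gamma> v (tens q r) u A \<in> theorems"
| weak: "\<lbrakk>Eq \<Gamma> v q w A \<in> theorems; r \<in> B; r \<le> q\<rbrakk> \<Longrightarrow> Eq \<Gamma> v r w A \<in> theorems"
| arch:
    "\<lbrakk>q \<in> B; \<And>r. r \<in> B \<Longrightarrow> r \<lless> q \<Longrightarrow> Eq \<Gamma> v r w A \<in> theorems\<rbrakk> \<Longrightarrow> Eq \<Gamma> v q w A \<in> theorems"
| join:
    "\<lbrakk>J = Finite_Joins; S \<turnstile> \<Gamma> \<rhd> v \<Colon> A; S \<turnstile> \<Gamma> \<rhd> w \<Colon> A;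
      \<And>i. i \<in> {1..n::nat} \<Longrightarrow> Eq \<Gamma> v (q i) w A \<in> theorems\<rbrakk>
     \<Longrightarrow> Eq \<Gamma> v (SUP i\<in>{1..n}. q i) w A \<in> theorems"
| bottom:
    "\<lbrakk>J = Bottom_Axiom; S \<turnstile> \<Gamma> \<rhd> v \<Colon> A; S \<turnstile> \<Gamma> \<rhd> w \<Colon> A\<rbrakk> \<Longrightarrow> Eq \<Gamma> v bot w A \<in> theorems"
| sym: "\<lbrakk>symmetric; Eq \<Gamma> v q w A \<in> theorems\<rbrakk> \<Longrightarrow> Eq \<Gamma> w q v A \<in> theorems"
| cong_op:
    "\<lbrakk>f \<in> ops S; length \<Gamma>s = length (arg_tys S f); length vs = length (arg_tys S f);
      length qs = length (arg_tys S f); length ws = length (arg_tys S f);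
      \<And>i. i < length (arg_tys S f) \<Longrightarrow>
        Eq (\<Gamma>s ! i) (vs ! i) (qs ! i) (ws ! i) (arg_tys S f ! i) \<in> theorems;
      E \<in> Sf \<Gamma>s\<rbrakk>
     \<Longrightarrow> Eq E (Op f vs) (foldr tens qs unit) (Op f ws) (res_ty S f) \<in> theorems"
| cong_pair:
    "\<lbrakk>Eq \<Gamma> v q w A \<in> theorems; Eq \<Delta> v' r w' A' \<in> theorems; E \<in> Sf [\<Gamma>, \<Delta>]\<rbrakk>
     \<Longrightarrow> Eq E (TPair v v') (tens q r) (TPair w w') (Tensor A A') \<in> theorems"
| cong_pm:
    "\<lbrakk>Eq \<Gamma> v q w (Tensor A A') \<in> theorems; Eq (\<Delta> @ [(x, A), (y, A')]) v' r w' C \<in> theorems;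
      E \<in> Sf [\<Gamma>, \<Delta>]\<rbrakk>
     \<Longrightarrow> Eq E (pm v x y v') (tens q r) (pm w x y w') C \<in> theorems"
| cong_to:
    "\<lbrakk>Eq \<Gamma> v q w One \<in> theorems; Eq \<Delta> v' r w' A \<in> theorems; E \<in> Sf [\<Gamma>, \<Delta>]\<rbrakk>
     \<Longrightarrow> Eq E (To v v') (tens q r) (To w w') A \<in> theorems"
| cong_app:
    "\<lbrakk>Eq \<Gamma> v q w (Lolli A A') \<in> theorems; Eq \<Delta> v' r w' A \<in> theorems; E \<in> Sf [\<Gamma>, \<Delta>]\<rbrakk>
     \<Longrightarrow> Eq E (App v v') (tens q r) (App w w') A' \<in> theorems"
| cong_lam:
    "Eq (\<Gamma> @ [(x, A)]) v q w A' \<in> theorems \<Longrightarrow> Eq \<Gamma> (lam x v) q (lam x w) (Lolli A A') \<in> theorems"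
| cong_subst:
    "\<lbrakk>Eq (\<Gamma> @ [(x, A)]) v q w A' \<in> theorems; Eq \<Delta> v' r w' A \<in> theorems; wf_ctx (\<Gamma> @ \<Delta>)\<rbrakk>
     \<Longrightarrow> Eq (\<Gamma> @ \<Delta>) (subst1 v x v') (tens q r) (subst1 w x w') A' \<in> theorems"
| perm: "\<lbrakk>Eq \<Gamma> v q w A \<in> theorems; mset \<Delta> = mset \<Gamma>\<rbrakk> \<Longrightarrow> Eq \<Delta> v q w A \<in> theorems"

end

end

theory Submission
  imports Defs
begin

text \<open>The two systems share every rule except \<open>join\<close> and \<open>bottom\<close>,
  so it is enough to derive each of these from the rules of the other system; induction on
  derivations does the rest. The bottom axiom is the join rule for the empty family. Conversely, in
  a chain a nonempty finite join is attained (\<open>Sup_in_finite_total\<close>), so the conclusion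
  of a nonempty join is already one of its premises.\<close>

lemma Sup_in_finite_total:
  fixes X :: "'v::complete_lattice set"
  assumes "finite X" "X \<noteq> {}" and total: "\<forall>x y :: 'v. x \<le> y \<or> y \<le> x"
  shows "Sup X \<in> X"
  using assms(1,2)
proof (induction rule: finite_ne_induct)
  case (insert x F)
  have "sup x (Sup F) = x \<or> sup x (Sup F) = Sup F"
    using total by (metis sup.absorb1 sup.absorb2)
  with insert.IH show ?case by auto
qed simp

lemma bottom_axiom_theorems_subset:
  "theorems tens unit B Bottom_Axiom symmetric S Ax
    \<subseteq> theorems tens unit B Finite_Joins symmetric S Ax"
proof
  fix e
  assume "e \<in> theorems tens unit B Bottom_Axiom symmetric S Ax"
  then show "e \<in> theorems tens unit B Finite_Joins symmetric S Ax"
  proof induction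
    case (bottom \<Gamma> v A w)
    \<comment> \<open>For \<open>n = 0\<close> the index set \<open>{1..n}\<close> is empty: only
      the typing premises remain, and the label is \<open>Sup {} = bot\<close>.\<close>
    then show ?case
      using theorems.join[where n = 0 and J = Finite_Joins] by fastforce
  qed (blast intro: theorems.intros)+
qed

lemma finite_joins_theorems_subset:
  fixes tens :: "'v::complete_lattice \<Rightarrow> 'v \<Rightarrow> 'v"
  assumes total: "\<forall>x y :: 'v. x \<le> y \<or> y \<le> x"
  shows "theorems tens unit B Finite_Joins symmetric S Ax
    \<subseteq> theorems tens unit B Bottom_Axiom symmetric S Ax"
proof
  fix e
  assume "e \<in> theorems tens unit B Finite_Joins symmetric S Ax"
  then show "e \<in> theorems tens unit B Bottom_Axiom symmetric S Ax"
  proof induction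
    case (join \<Gamma> v A w n q)
    show ?case
    proof (cases "n = 0")
      case True
      \<comment> \<open>The typing premises of \<open>join\<close> are those that
        \<open>bottom\<close> requires.\<close>
      with join.hyps show ?thesis by (simp add: theorems.bottom)
    next
      case False
      \<comment> \<open>The joined label equals some \<open>q i\<close>, and the induction
        hypothesis for that \<open>i\<close> is the goal.\<close>
      then have "Sup (q ` {1..n}) \<in> q ` {1..n}"
        by (intro Sup_in_finite_total total) auto
      with join.IH show ?thesis by auto
    qed
  qed (blast intro: theorems.intros)+
qed

theorem theoremA1:
  fixes tens :: "'v::complete_lattice \<Rightarrow> 'v \<Rightarrow> 'v"
    and unit :: 'v
    and B :: "'v set"
    and S :: "('g, 'f) signature"
    and Ax :: "('g, 'f, 'v) equation set"
    and symmetric :: bool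
  assumes "based_quantale tens unit B"
    and "\<forall>x y :: 'v. x \<le> y \<or> y \<le> x"
    and "linear_theory B S Ax"
  shows "theorems tens unit B Finite_Joins symmetric S Ax
       = theorems tens unit B Bottom_Axiom symmetric S Ax"
  using assms(2)
  by (intro subset_antisym finite_joins_theorems_subset bottom_axiom_theorems_subset)

end
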